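(* Let $A$ and $B$ be sets with $|A| = k \geq 2$ and $|B| \geq 2$, and let $n\geq 1$. Then a subgroup $G$ of $S_n$ is the invariance group of some function $f \colon A^n \to B$ determined by $\mathrm{cs}$ if and only if there exists a family $(G_\ell)_{\ell\in Z(k,n)}$ of permutation groups $G_\ell \leq S_\ell$ such that $G = \bigcap_{\ell\in Z(k,n)} \mathrm{Comp}^{(n)} G_\ell$.
   Context: For $\mathbf{a}\in A^n$ and $\sigma\in S_n$, $\mathbf{a}\sigma := (a_{\sigma(1)},\dots,a_{\sigma(n)})$; the invariance group of $f\colon A^n\to B$ is $\mathrm{Inv} f := \{\sigma\in S_n : f(\mathbf{a}\sigma) = f(\mathbf{a})\ \forall\mathbf{a}\in A^n\}$. The content $\mathrm{ms}(\mathbf{a})$ is the multiset of entries of $\mathbf{a}$; a singleton of $\mathbf{a}$ is an element occurring exactly once; $\mathrm{singles}(\mathbf{a})$ lists the singletons in order of occurrence; $\mathrm{cs}(\mathbf{a}) := (\mathrm{ms}(\mathbf{a}),\mathrm{singles}(\mathbf{a}))$; $f$ is determined by $\mathrm{cs}$ if $f(\mathbf{a})=f(\mathbf{b})$ whenever $\mathrm{cs}(\mathbf{a}) = \mathrm{cs}(\mathbf{b})$. $Z(k,n) := \{0,1,\dots,k-1\}$ if $k<n$ and $Z(k,n):=\{0,1,\dots,n\}\setminus\{n-1\}$ if $k\geq n$. Patterns: for $S\subseteq\{1,\dots,n\}$, $|S|=\ell$, $h_S\colon\{1,\dots,\ell\}\to S$ is the order-isomorphism and $\sigma_S := h_{\sigma(S)}^{-1}\circ\sigma|_S\circ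 h_S\in S_\ell$; $\mathrm{Pat}^{(\ell)}\sigma := \{\sigma_S : |S|=\ell\}$; for $G\subseteq S_\ell$, $\mathrm{Comp}^{(n)} G := \{\pi\in S_n : \mathrm{Pat}^{(\ell)}\pi\subseteq G\}$. ($S_0$ is the trivial group.) *)

theory Defs
  imports "HOL-Algebra.Sym_Groups" "HOL-Library.Extended_Nat" "HOL-Library.FuncSet"
    "HOL-Library.Multiset"
begin

text \<open>The cardinality of a possibly infinite set; all infinite cardinalities are identified,
  since the number of elements of \<open>A\<close> only matters through its comparison with \<open>n\<close>.\<close>

definition ecard :: "'a set \<Rightarrow> enat" where
  "ecard A = (if finite A then enat (card A) else \<infinity>)"

text \<open>An \<open>n\<close>-tuple over \<open>A\<close> is an extensional function on the index set \<open>{1..n}\<close>;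
  elements of \<open>S\<^sub>n\<close> are functions on all of \<open>nat\<close> that permute \<open>{1..n}\<close> and fix every other
  number (the carrier of \<^const>\<open>sym_group\<close>).\<close>

definition tuples :: "nat \<Rightarrow> 'a set \<Rightarrow> (nat \<Rightarrow> 'a) set" where
  "tuples n A = {1..n} \<rightarrow>\<^sub>E A"

definition act :: "nat \<Rightarrow> (nat \<Rightarrow> 'a) \<Rightarrow> (nat \<Rightarrow> nat) \<Rightarrow> (nat \<Rightarrow> 'a)" where
  "act n a \<sigma> = (\<lambda>i\<in>{1..n}. a (\<sigma> i))"

definition Inv_group :: "nat \<Rightarrow> 'a set \<Rightarrow> ((nat \<Rightarrow> 'a) \<Rightarrow> 'b) \<Rightarrow> (nat \<Rightarrow> nat) set" where
  "Inv_group n A f = {\<sigma> \<in> carrier (sym_group n). \<forall>a\<in>tuples n A. f (act n a \<sigma>) = f a}"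

definition ms :: "nat \<Rightarrow> (nat \<Rightarrow> 'a) \<Rightarrow> 'a multiset" where
  "ms n a = image_mset a (mset_set {1..n})"

definition singles :: "nat \<Rightarrow> (nat \<Rightarrow> 'a) \<Rightarrow> 'a list" where
  "singles n a = filter (\<lambda>x. count (ms n a) x = 1) (map a [1..<Suc n])"

definition cs :: "nat \<Rightarrow> (nat \<Rightarrow> 'a) \<Rightarrow> 'a multiset \<times> 'a list" where
  "cs n a = (ms n a, singles n a)"

definition determined_by_cs :: "nat \<Rightarrow> 'a set \<Rightarrow> ((nat \<Rightarrow> 'a) \<Rightarrow> 'b) \<Rightarrow> bool" where
  "determined_by_cs n A f \<longleftrightarrow>
     (\<forall>a\<in>tuples n A. \<forall>b\<in>tuples n A. cs n a = cs n b \<longrightarrow> f a = f b)"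

definition Z :: "enat \<Rightarrow> nat \<Rightarrow> nat set" where
  "Z k n = (if k < enat n then {l. enat l < k} else {0..n} - {n - 1})"

text \<open>The order isomorphism \<open>h\<^sub>S\<close> from \<open>{1..card S}\<close> to a finite set \<open>S\<close>; see \<open>order_iso\<close> below.\<close>

definition h :: "nat set \<Rightarrow> nat \<Rightarrow> nat" where
  "h S i = sorted_list_of_set S ! (i - 1)"

lemma order_iso:
  assumes "finite S"
  shows "bij_betw (h S) {1..card S} S" and "strict_mono_on {1..card S} (h S)"
proof -
  show mono: "strict_mono_on {1..card S} (h S)"
    by (rule strict_mono_onI)
      (auto simp: h_def intro!: sorted_wrt_nth_less[OF strict_sorted_list_of_set])
  have "h S ` {1..card S} \<subseteq> S"
  proof
    fix x assume "x \<in> h S ` {1..card S}"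
    then obtain i where "i \<in> {1..card S}" "x = sorted_list_of_set S ! (i - 1)"
      by (auto simp: h_def)
    moreover from this have "i - 1 < length (sorted_list_of_set S)" by auto
    ultimately have "x \<in> set (sorted_list_of_set S)" by (metis nth_mem)
    then show "x \<in> S" using assms by simp
  qed
  moreover have "inj_on (h S) {1..card S}" using mono by (rule strict_mono_on_imp_inj_on)
  ultimately show "bij_betw (h S) {1..card S} S"
    using assms by (simp add: bij_betw_def card_image card_subset_eq)
qed

text \<open>The pattern \<open>\<sigma>\<^sub>S = h\<^bsub>\<sigma>(S)\<^esub>\<^sup>-\<^sup>1 \<circ> \<sigma>|\<^sub>S \<circ> h\<^sub>S\<close>, extended by the identity so as to lie in the carrier
  of \<^const>\<open>sym_group\<close>.\<close>

definition pattern :: "(nat \<Rightarrow> nat) \<Rightarrow> nat set \<Rightarrow> (nat \<Rightarrow> nat)" where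
  "pattern \<sigma> S = (\<lambda>i. if i \<in> {1..card S}
      then inv_into {1..card S} (h (\<sigma> ` S)) (\<sigma> (h S i)) else i)"

definition Pat :: "nat \<Rightarrow> nat \<Rightarrow> (nat \<Rightarrow> nat) \<Rightarrow> (nat \<Rightarrow> nat) set" where
  "Pat n l \<sigma> = {pattern \<sigma> S | S. S \<subseteq> {1..n} \<and> card S = l}"

definition Comp :: "nat \<Rightarrow> nat \<Rightarrow> (nat \<Rightarrow> nat) set \<Rightarrow> (nat \<Rightarrow> nat) set" where
  "Comp n l G = {\<pi> \<in> carrier (sym_group n). Pat n l \<pi> \<subseteq> G}"

end

theory Submission
  imports Defs
begin

text \<open>If the singletons of \<open>a\<close> occupy the positions \<open>S\<close>, then those of \<open>a\<sigma>\<close> occupy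
  \<open>T = \<sigma>\<^sup>-\<^sup>1(S)\<close>, and \<open>singles(a\<sigma>)\<close> is \<open>singles(a)\<close> permuted by the pattern \<open>\<sigma>\<^sub>T\<close>. Every set of
  positions of the right size occurs as \<open>S\<close> for some tuple with the same content and the same
  word of singletons. Hence \<open>\<sigma>\<close> leaves \<open>f\<close> invariant iff, for every number \<open>l\<close> of singletons, all
  \<open>l\<close>-patterns of \<open>\<sigma>\<close> lie in the group of those \<open>\<tau> \<in> S\<^sub>l\<close> that leave \<open>f\<close> invariant when applied to
  the word of singletons; and \<open>Z k n\<close> is the set of possible values of \<open>l\<close>. Conversely, given
  groups \<open>H\<^sub>l\<close>, take for \<open>f\<close> the indicator function of those tuples whose content is
  \<open>{x\<^sub>1, \<dots>, x\<^sub>l}\<close> together with \<open>n - l\<close> copies of \<open>x\<^bsub>l+1\<^esub>\<close> and whose word of singletons is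
  \<open>x\<^bsub>\<tau>(1)\<^esub> \<dots> x\<^bsub>\<tau>(l)\<^esub>\<close> for some \<open>\<tau> \<in> H\<^sub>l\<close>.\<close>

section \<open>Positions of the singletons and the word they spell\<close>

text \<open>Singletons are recorded by position rather than by value, since permutations and their
  patterns act on positions.\<close>

definition sing_pos :: "nat \<Rightarrow> (nat \<Rightarrow> 'a) \<Rightarrow> nat set" where
  "sing_pos n a = {i \<in> {1..n}. \<forall>j\<in>{1..n}. a j = a i \<longrightarrow> j = i}"

lemma sing_pos_subset: "sing_pos n a \<subseteq> {1..n}"
  by (auto simp: sing_pos_def)

lemma sing_posD: "i \<in> sing_pos n a \<Longrightarrow> j \<in> {1..n} \<Longrightarrow> a j = a i \<Longrightarrow> j = i"
  by (simp add: sing_pos_def)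

lemma finite_sing_pos [simp]: "finite (sing_pos n a)"
  by (rule finite_subset[OF sing_pos_subset]) simp

text \<open>The multiplicity of \<open>a i\<close> in the content is the number of positions
  carrying that value, so it is 1 exactly if \<open>i\<close> is the only such position.\<close>

lemma count_ms_eq_1_iff:
  assumes "i \<in> {1..n}"
  shows "count (ms n a) (a i) = 1 \<longleftrightarrow> i \<in> sing_pos n a"
proof -
  have eq: "count (ms n a) (a i) = card {j \<in> {1..n}. a j = a i}"
  proof -
    have "count (ms n a) (a i) = (\<Sum>j\<in>{j \<in> {1..n}. a j = a i}. 1)"
      unfolding ms_def count_image_mset by (intro sum.cong) auto
    then show ?thesis by simp
  qed
  show ?thesis
  proof
    assume "count (ms n a) (a i) = 1"
    then obtain j where "{j \<in> {1..n}. a j = a i} = {j}"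
      using eq card_1_singletonE by metis
    moreover have "i \<in> {j \<in> {1..n}. a j = a i}"
      using assms by simp
    ultimately have "{j \<in> {1..n}. a j = a i} = {i}"
      by (metis singletonD)
    then have "\<forall>j\<in>{1..n}. a j = a i \<longrightarrow> j = i"
      by blast
    then show "i \<in> sing_pos n a"
      using assms unfolding sing_pos_def by simp
  next
    assume "i \<in> sing_pos n a"
    then have "{j \<in> {1..n}. a j = a i} = {i}"
      unfolding sing_pos_def by blast
    then show "count (ms n a) (a i) = 1"
      using eq by simp
  qed
qed

lemma h_mem: "finite S \<Longrightarrow> i \<in> {1..card S} \<Longrightarrow> h S i \<in> S"
  using order_iso(1) by (metis bij_betwE)

lemma map_h: "map (h S) [1..<Suc (card S)] = sorted_list_of_set S"
  by (rule nth_equalityI) (auto simp: h_def nth_append simp del: upt_Suc)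

lemma h_initial_segment: "i \<in> {1..l} \<Longrightarrow> h {1..l} i = i"
proof -
  have "sorted_list_of_set {1..l} = [1..<Suc l]"
    by (metis atLeastLessThanSuc_atLeastAtMost sorted_list_of_set_range)
  then show "i \<in> {1..l} \<Longrightarrow> h {1..l} i = i"
    by (auto simp: h_def simp del: upt_Suc)
qed

text \<open>Filtering by value before reading off entries amounts to filtering positions first. The
  surviving positions form an increasing list, which \<open>h\<close> enumerates.\<close>

lemma singles_eq:
  "singles n a = map (\<lambda>i. a (h (sing_pos n a) i)) [1..<Suc (card (sing_pos n a))]"
proof -
  have "singles n a = map a (filter (\<lambda>i. count (ms n a) (a i) = 1) [1..<Suc n])"
    by (simp add: singles_def filter_map o_def)
  also have "filter (\<lambda>i. count (ms n a) (a i) = 1) [1..<Suc n]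
      = filter (\<lambda>i. i \<in> sing_pos n a) [1..<Suc n]"
    using count_ms_eq_1_iff[of _ n a] by (intro filter_cong) auto
  also have "\<dots> = sorted_list_of_set (sing_pos n a)"
    using sing_pos_subset[of n a]
    by (intro strict_sorted_equal) (auto simp: sorted_wrt_filter simp del: upt_Suc)
  finally show ?thesis
    by (simp add: map_h[symmetric] o_def del: upt_Suc)
qed

lemma length_singles: "length (singles n a) = card (sing_pos n a)"
  by (simp add: singles_eq del: upt_Suc)

lemma singles_nth:
  assumes "i \<in> {1..card (sing_pos n a)}"
  shows "singles n a ! (i - 1) = a (h (sing_pos n a) i)"
  using assms by (auto simp: singles_eq simp del: upt_Suc)

lemma singles_eqI:
  assumes "sing_pos n a = S" "card S = l" "\<And>i. i \<in> {1..l} \<Longrightarrow> a (h S i) = w i"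
  shows "singles n a = map w [1..<Suc l]"
  unfolding singles_eq assms(1,2) using assms(3) by (intro map_cong) auto

text \<open>Comparing lengths yields the number of singletons; comparing entries then yields the
  values.\<close>

lemma singles_eqD:
  assumes "singles n a = map w [1..<Suc l]" "i \<in> {1..l}"
  shows "a (h (sing_pos n a) i) = w i"
proof -
  have "card (sing_pos n a) = l"
    unfolding length_singles[symmetric] assms(1) by (simp del: upt_Suc)
  then have "a (h (sing_pos n a) i) = map w [1..<Suc l] ! (i - 1)"
    using assms singles_nth[of i n a] by metis
  then show ?thesis
    using assms(2) by (auto simp del: upt_Suc)
qed

section \<open>The action of permutations on tuples\<close>

lemma mem_sym_group: "\<sigma> \<in> carrier (sym_group n) \<longleftrightarrow> \<sigma> permutes {1..n}"
  by (simp add: sym_group_def)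

lemma act_mem_tuples: "a \<in> tuples n A \<Longrightarrow> \<sigma> permutes {1..n} \<Longrightarrow> act n a \<sigma> \<in> tuples n A"
  by (auto simp: tuples_def act_def permutes_in_image simp del: atLeastAtMost_iff)

lemma ms_act:
  assumes "\<sigma> permutes {1..n}"
  shows "ms n (act n a \<sigma>) = ms n a"
proof -
  have "ms n (act n a \<sigma>) = image_mset (\<lambda>i. a (\<sigma> i)) (mset_set {1..n})"
    unfolding ms_def act_def by (intro image_mset_cong) simp
  also have "\<dots> = image_mset a (image_mset \<sigma> (mset_set {1..n}))"
    by (simp add: image_mset.compositionality o_def)
  also have "image_mset \<sigma> (mset_set {1..n}) = mset_set {1..n}"
    using assms by (simp add: image_mset_mset_set permutes_inj_on permutes_image)
  finally show ?thesis
    by (simp add: ms_def)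
qed

lemma mem_sing_pos_act:
  assumes "\<sigma> permutes {1..n}"
  shows "i \<in> sing_pos n (act n a \<sigma>) \<longleftrightarrow> \<sigma> i \<in> sing_pos n a"
proof -
  have eq: "(\<forall>j\<in>{1..n}. a (\<sigma> j) = a (\<sigma> i) \<longrightarrow> j = i) \<longleftrightarrow> (\<forall>j\<in>{1..n}. a j = a (\<sigma> i) \<longrightarrow> j = \<sigma> i)"
    \<comment> \<open>Only the range on the right is rewritten as the image of
      \<open>\<sigma>\<close>; injectivity then cancels \<open>\<sigma>\<close>.\<close>
    using permutes_inj[OF assms] by (subst (2) permutes_image[OF assms, symmetric]) (auto dest: injD)
  have "i \<in> sing_pos n (act n a \<sigma>) \<longleftrightarrow>
      i \<in> {1..n} \<and> (\<forall>j\<in>{1..n}. a (\<sigma> j) = a (\<sigma> i) \<longrightarrow> j = i)"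
    by (auto simp: sing_pos_def act_def)
  then show ?thesis
    unfolding eq sing_pos_def using permutes_in_image[OF assms] by blast
qed

lemma image_sing_pos_act:
  assumes "\<sigma> permutes {1..n}"
  shows "\<sigma> ` sing_pos n (act n a \<sigma>) = sing_pos n a"
proof -
  have "sing_pos n (act n a \<sigma>) = \<sigma> -` sing_pos n a"
    using mem_sing_pos_act[OF assms] by blast
  then show ?thesis
    using permutes_surj[OF assms] by (simp add: surj_image_vimage_eq)
qed

lemma card_sing_pos_act:
  assumes "\<sigma> permutes {1..n}"
  shows "card (sing_pos n (act n a \<sigma>)) = card (sing_pos n a)"
  using image_sing_pos_act[OF assms] card_image[OF permutes_inj_on[OF assms]] by metis

section \<open>Patterns\<close>

lemma card_image_permutes: "\<sigma> permutes X \<Longrightarrow> card (\<sigma> ` S) = card S"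
  by (rule card_image[OF permutes_inj_on])

text \<open>This commuting square characterizes the pattern and replaces its definition through
  \<open>inv_into\<close> from here on.\<close>

lemma h_pattern:
  assumes "\<sigma> permutes {1..n}" "finite T" "i \<in> {1..card T}"
  shows "h (\<sigma> ` T) (pattern \<sigma> T i) = \<sigma> (h T i)"
proof -
  have "h (\<sigma> ` T) ` {1..card T} = \<sigma> ` T"
    using order_iso(1)[of "\<sigma> ` T"] assms
    by (simp add: card_image_permutes bij_betw_def)
  then have "\<sigma> (h T i) \<in> h (\<sigma> ` T) ` {1..card T}"
    using assms h_mem by auto
  then show ?thesis
    using assms(3) unfolding pattern_def by (simp add: f_inv_into_f)
qed

lemma pattern_permutes:
  assumes "\<sigma> permutes {1..n}" "finite T"
  shows "pattern \<sigma> T permutes {1..card T}"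
proof (rule bij_imp_permutes)
  have 1: "bij_betw (h (\<sigma> ` T)) {1..card T} (\<sigma> ` T)"
    using order_iso(1)[of "\<sigma> ` T"] assms by (simp add: card_image_permutes)
  have 2: "bij_betw \<sigma> T (\<sigma> ` T)"
    using assms by (auto intro: inj_on_imp_bij_betw permutes_inj_on)
  have "bij_betw (inv_into {1..card T} (h (\<sigma> ` T)) \<circ> (\<sigma> \<circ> h T)) {1..card T} {1..card T}"
    by (rule bij_betw_trans[OF bij_betw_trans[OF order_iso(1)[OF assms(2)] 2]
        bij_betw_inv_into[OF 1]])
  then show "bij_betw (pattern \<sigma> T) {1..card T} {1..card T}"
    by (rule bij_betw_cong[THEN iffD1, rotated]) (simp add: pattern_def)
qed (auto simp: pattern_def)

text \<open>As \<open>\<sigma>\<close> maps \<open>T\<close> onto the singleton positions of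
  \<open>a\<close>, the square for the pattern shows that the word of the permuted tuple is the word
  of \<open>a\<close> reindexed by the pattern.\<close>

lemma act_h:
  assumes "\<sigma> permutes {1..n}" "T = sing_pos n (act n a \<sigma>)" "i \<in> {1..card T}"
  shows "act n a \<sigma> (h T i) = a (h (sing_pos n a) (pattern \<sigma> T i))"
proof -
  have "h T i \<in> {1..n}"
    using h_mem assms(2,3) finite_sing_pos sing_pos_subset by (metis subsetD)
  then have "act n a \<sigma> (h T i) = a (\<sigma> (h T i))"
    by (simp add: act_def)
  also have "\<sigma> (h T i) = h (\<sigma> ` T) (pattern \<sigma> T i)"
    using assms by (simp add: h_pattern)
  finally show ?thesis
    using assms by (simp add: image_sing_pos_act)
qed

section \<open>Moving singletons to prescribed positions\<close>

text \<open>The complements of \<open>S\<close> and \<open>T\<close> in the finite set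
  \<open>X\<close> have equal size, so \<open>g\<close> can be glued to any bijection between
  them.\<close>

lemma ex_permutes_extending:
  assumes "finite X" "S \<subseteq> X" "T \<subseteq> X" "bij_betw g S T"
  obtains \<rho> where "\<rho> permutes X" "\<And>i. i \<in> S \<Longrightarrow> \<rho> i = g i"
proof -
  have fin: "finite S" "finite T" using assms finite_subset by blast+
  have "card (X - S) = card (X - T)"
    using assms fin by (simp add: card_Diff_subset bij_betw_same_card[OF assms(4)])
  then obtain g' where g': "bij_betw g' (X - S) (X - T)"
    using finite_same_card_bij[of "X - S" "X - T"] assms(1) by auto
  define \<rho> where "\<rho> i = (if i \<in> S then g i else if i \<in> X then g' i else i)" for i
  have 1: "bij_betw \<rho> S T"
    using assms(4) by (rule bij_betw_cong[THEN iffD1, rotated]) (simp add: \<rho>_def)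
  have 2: "bij_betw \<rho> (X - S) (X - T)"
    using g' by (rule bij_betw_cong[THEN iffD1, rotated]) (simp add: \<rho>_def)
  have "bij_betw \<rho> (S \<union> (X - S)) (T \<union> (X - T))"
    by (rule bij_betw_combine[OF 1 2]) auto
  then have "bij_betw \<rho> X X"
    using assms by (simp add: Un_absorb1)
  then have "\<rho> permutes X"
    using assms by (auto intro!: bij_imp_permutes simp: \<rho>_def)
  then show thesis
    by (rule that) (simp add: \<rho>_def)
qed

text \<open>Serves two purposes: with \<tau> the identity it moves the singletons and keeps the
  word; with \<open>S\<close> the old set of positions it only reorders the word.\<close>

lemma ex_act_with_sing_pos:
  assumes "S \<subseteq> {1..n}" "card S = l" "card (sing_pos n a) = l" "\<tau> permutes {1..l}"
  obtains \<rho> where "\<rho> permutes {1..n}" "sing_pos n (act n a \<rho>) = S"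
    "\<And>i. i \<in> {1..l} \<Longrightarrow> act n a \<rho> (h S i) = a (h (sing_pos n a) (\<tau> i))"
proof -
  let ?L = "{1..l}" and ?P = "sing_pos n a"
  have fS: "finite S" using assms(1) finite_subset by blast
  have hS: "bij_betw (h S) ?L S" using order_iso(1)[OF fS] assms(2) by simp
  have hP: "bij_betw (h ?P) ?L ?P" using order_iso(1)[of ?P] assms(3) by simp
  \<comment> \<open>The \<open>i\<close>-th element of \<open>S\<close> is sent to the singleton
    position with index \<open>\<tau> i\<close>.\<close>
  have "bij_betw (h ?P \<circ> (\<tau> \<circ> inv_into ?L (h S))) S ?P"
    by (rule bij_betw_trans[OF bij_betw_trans[OF bij_betw_inv_into[OF hS]
          permutes_imp_bij[OF assms(4)]] hP])
  then obtain \<rho> where \<rho>: "\<rho> permutes {1..n}"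
      "\<And>i. i \<in> S \<Longrightarrow> \<rho> i = (h ?P \<circ> (\<tau> \<circ> inv_into ?L (h S))) i"
    using ex_permutes_extending[of "{1..n}" S ?P] assms(1) sing_pos_subset by (metis finite_atLeastAtMost)
  have "\<rho> ` S = ?P"
    using \<rho>(2) \<open>bij_betw _ S ?P\<close> by (metis (no_types, lifting) bij_betw_imp_surj_on image_cong)
  then have "sing_pos n (act n a \<rho>) = S"
    using image_sing_pos_act[OF \<rho>(1), of a] permutes_inj[OF \<rho>(1)]
    by (metis inj_image_eq_iff)
  moreover have "act n a \<rho> (h S i) = a (h ?P (\<tau> i))" if "i \<in> ?L" for i
  proof -
    have "h S i \<in> S" using h_mem[OF fS] that assms(2) by blast
    moreover have "inv_into ?L (h S) (h S i) = i"
      by (rule bij_betw_inv_into_left[OF hS that])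
    ultimately show ?thesis
      using assms(1) \<rho>(2) by (auto simp: act_def)
  qed
  ultimately show thesis
    using that \<rho>(1) by blast
qed

section \<open>The possible numbers of singletons\<close>

text \<open>If all positions but one carry singletons, the last entry is a singleton too, which
  excludes \<open>n - 1\<close>. If A has fewer than \<open>n\<close> elements, some entry is
  repeated, and its value is an element of A besides the singletons.\<close>

lemma card_sing_pos_in_Z:
  assumes "a \<in> tuples n A" "n \<ge> 1"
  shows "card (sing_pos n a) \<in> Z (ecard A) n"
proof -
  let ?P = "sing_pos n a"
  have le: "card ?P \<le> n"
    using card_mono[OF _ sing_pos_subset] by (metis card_atLeastAtMost diff_Suc_1 finite_atLeastAtMost)
  have inj: "inj_on a ?P"
    using sing_posD[of _ n a] sing_pos_subset[of n a] by (intro inj_onI) blast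
  have img: "a ` {1..n} \<subseteq> A"
    using assms by (auto simp: tuples_def)
  have ne: "card ?P \<noteq> n - 1"
  proof
    assume "card ?P = n - 1"
    then have "card ({1..n} - ?P) = 1"
      using assms(2) sing_pos_subset[of n a] by (simp add: card_Diff_subset)
    then obtain j where j: "{1..n} - ?P = {j}"
      by (rule card_1_singletonE)
    have "i = j" if "i \<in> {1..n}" "a i = a j" for i
    proof (rule ccontr)
      assume "i \<noteq> j"
      then have "i \<in> ?P" "j \<in> {1..n}" using j that by blast+
      then show False using that \<open>i \<noteq> j\<close> by (simp add: sing_pos_def)
    qed
    moreover have "j \<in> {1..n}" "j \<notin> ?P" using j by blast+
    ultimately show False by (simp add: sing_pos_def)
  qed
  show ?thesis
  proof (cases "ecard A < enat n")
    case True
    then have fin: "finite A" and cA: "card A < n" "ecard A = enat (card A)"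
      by (auto simp: ecard_def split: if_splits)
    have "card ?P < card A"
    proof (cases "?P = {1..n}")
      case True
      then have "n \<le> card A"
        using card_inj_on_le[OF _ _ fin, of a ?P] inj img by simp
      then show ?thesis using cA by simp
    next
      case False
      then obtain j where j: "j \<in> {1..n}" "j \<notin> ?P"
        using sing_pos_subset by blast
      then have "a j \<notin> a ` ?P" using sing_posD[of _ n a j] by blast
      then have "a ` ?P \<subset> A"
        using img sing_pos_subset[of n a] j by blast
      then show ?thesis
        using psubset_card_mono[OF fin] card_image[OF inj] by metis
    qed
    then show ?thesis using True cA by (simp add: Z_def)
  next
    case False
    then show ?thesis using le ne by (simp add: Z_def)
  qed
qed

lemma Z_le: "l \<in> Z k n \<Longrightarrow> l \<le> n"
  by (cases k) (auto simp: Z_def split: if_splits)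

lemma Z_neq: "l \<in> Z k n \<Longrightarrow> n \<ge> 1 \<Longrightarrow> l \<noteq> n - 1"
  by (cases k) (auto simp: Z_def split: if_splits)

text \<open>The intersection of an empty family would be \<open>UNIV\<close>, not S_n. The witnesses
  are 0 for \<open>k < enat n\<close> and \<open>n\<close> otherwise.\<close>

lemma Z_nonempty:
  assumes "k \<ge> 2" "n \<ge> 1"
  shows "Z k n \<noteq> {}"
proof (cases "k < enat n")
  case True
  have "enat 0 < k" using assms(1) by (metis enat_0 not_numeral_le_zero zero_less_iff_neq_zero)
  then show ?thesis using True by (auto simp: Z_def)
next
  case False
  then have "n \<in> Z k n" using assms(2) by (auto simp: Z_def)
  then show ?thesis by blast
qed

section \<open>From a function determined by cs to a family of groups\<close>

lemma mem_Inter_Comp: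
  assumes "Z k n \<noteq> {}"
  shows "\<sigma> \<in> (\<Inter>l\<in>Z k n. Comp n l (H l)) \<longleftrightarrow> \<sigma> permutes {1..n} \<and>
    (\<forall>T. T \<subseteq> {1..n} \<and> card T \<in> Z k n \<longrightarrow> pattern \<sigma> T \<in> H (card T))"
  using assms by (auto simp: Comp_def Pat_def mem_sym_group)

text \<open>For fixed content with \<open>l\<close> singletons, \<open>f\<close> is a function of the word of singletons; this is
  the intersection of the invariance groups of these functions over all such contents.\<close>

definition word_inv :: "nat \<Rightarrow> 'a set \<Rightarrow> ((nat \<Rightarrow> 'a) \<Rightarrow> 'b) \<Rightarrow> nat \<Rightarrow> (nat \<Rightarrow> nat) set" where
  "word_inv n A f l = {\<tau>. \<tau> permutes {1..l} \<and>
     (\<forall>a\<in>tuples n A. \<forall>b\<in>tuples n A. card (sing_pos n a) = l \<longrightarrow> ms n a = ms n b \<longrightarrow>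
        singles n b = map (\<lambda>i. a (h (sing_pos n a) (\<tau> i))) [1..<Suc l] \<longrightarrow> f a = f b)}"

lemma word_invI:
  assumes "\<tau> permutes {1..l}"
    and "\<And>a b. a \<in> tuples n A \<Longrightarrow> b \<in> tuples n A \<Longrightarrow> card (sing_pos n a) = l \<Longrightarrow>
      ms n a = ms n b \<Longrightarrow>
      singles n b = map (\<lambda>i. a (h (sing_pos n a) (\<tau> i))) [1..<Suc l] \<Longrightarrow> f a = f b"
  shows "\<tau> \<in> word_inv n A f l"
  unfolding word_inv_def using assms by blast

lemma word_invD:
  assumes "\<tau> \<in> word_inv n A f l" "a \<in> tuples n A" "b \<in> tuples n A"
    "card (sing_pos n a) = l" "ms n a = ms n b"
    "singles n b = map (\<lambda>i. a (h (sing_pos n a) (\<tau> i))) [1..<Suc l]"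
  shows "f a = f b"
  using assms unfolding word_inv_def by blast

lemma word_inv_permutes: "\<tau> \<in> word_inv n A f l \<Longrightarrow> \<tau> permutes {1..l}"
  by (simp add: word_inv_def)

lemma determined_by_csD:
  assumes "determined_by_cs n A f" "a \<in> tuples n A" "b \<in> tuples n A"
    "ms n a = ms n b" "singles n a = singles n b"
  shows "f a = f b"
  using assms unfolding determined_by_cs_def cs_def by blast

text \<open>The identity fixes the word, so equality of cs applies. Products pass through an
  intermediate tuple, and inverses exchange the two tuples compared.\<close>

lemma subgroup_word_inv:
  assumes "determined_by_cs n A f"
  shows "subgroup (word_inv n A f l) (sym_group l)"
proof
  show "word_inv n A f l \<subseteq> carrier (sym_group l)"
    using word_inv_permutes by (auto simp: mem_sym_group)
  have "id \<in> word_inv n A f l"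
  proof (rule word_invI[OF permutes_id])
    fix a b assume *: "a \<in> tuples n A" "b \<in> tuples n A" "card (sing_pos n a) = l"
      "ms n a = ms n b" "singles n b = map (\<lambda>i. a (h (sing_pos n a) (id i))) [1..<Suc l]"
    have "singles n a = singles n b"
      unfolding singles_eq[of n a] *(3,5) id_apply ..
    with assms *(1,2,4) show "f a = f b"
      by (rule determined_by_csD)
  qed
  then show "\<one>\<^bsub>sym_group l\<^esub> \<in> word_inv n A f l"
    by (simp add: sym_group_def)
next
  fix \<sigma> \<tau> assume \<sigma>: "\<sigma> \<in> word_inv n A f l" and \<tau>: "\<tau> \<in> word_inv n A f l"
  have p\<tau>: "\<tau> permutes {1..l}"
    by (rule word_inv_permutes[OF \<tau>])
  have "\<sigma> \<circ> \<tau> \<in> word_inv n A f l"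
  proof (rule word_invI)
    show "\<sigma> \<circ> \<tau> permutes {1..l}"
      using p\<tau> word_inv_permutes[OF \<sigma>] by (rule permutes_compose)
  next
    fix a b assume a: "a \<in> tuples n A" and b: "b \<in> tuples n A"
      and card: "card (sing_pos n a) = l" and ms: "ms n a = ms n b"
      and sb: "singles n b = map (\<lambda>i. a (h (sing_pos n a) ((\<sigma> \<circ> \<tau>) i))) [1..<Suc l]"
    \<comment> \<open>The intermediate tuple keeps the singleton positions of \<open>a\<close> and
      has its word reordered by \<sigma>; reordering that word by \<tau> gives the word of
      \<open>b\<close>.\<close>
    obtain \<rho> where \<rho>: "\<rho> permutes {1..n}" "sing_pos n (act n a \<rho>) = sing_pos n a"
      "\<And>i. i \<in> {1..l} \<Longrightarrow> act n a \<rho> (h (sing_pos n a) i) = a (h (sing_pos n a) (\<sigma> i))"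
      using ex_act_with_sing_pos[OF sing_pos_subset card card word_inv_permutes[OF \<sigma>]] by blast
    let ?c = "act n a \<rho>"
    have c: "?c \<in> tuples n A" "ms n ?c = ms n a"
      using \<rho>(1) a by (simp_all add: act_mem_tuples ms_act)
    have fc: "f a = f ?c"
      using \<sigma> a c(1) card c(2)[symmetric] singles_eqI[OF \<rho>(2) card \<rho>(3)] by (rule word_invD)
    have sb': "singles n b = map (\<lambda>i. ?c (h (sing_pos n ?c) (\<tau> i))) [1..<Suc l]"
      unfolding sb \<rho>(2)
    proof (rule map_cong[OF refl])
      fix i assume "i \<in> set [1..<Suc l]"
      then have "\<tau> i \<in> {1..l}" using permutes_in_image[OF p\<tau>, of i] by auto
      then show "a (h (sing_pos n a) ((\<sigma> \<circ> \<tau>) i)) = ?c (h (sing_pos n a) (\<tau> i))"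
        using \<rho>(3) by simp
    qed
    from \<tau> c(1) b card[folded \<rho>(2)] trans[OF c(2) ms] sb' have "f ?c = f b"
      by (rule word_invD)
    with fc show "f a = f b" by simp
  qed
  then show "\<sigma> \<otimes>\<^bsub>sym_group l\<^esub> \<tau> \<in> word_inv n A f l"
    by (simp add: sym_group_def)
next
  fix \<sigma> assume \<sigma>: "\<sigma> \<in> word_inv n A f l"
  then have p: "\<sigma> permutes {1..l}" by (rule word_inv_permutes)
  have "inv' \<sigma> \<in> word_inv n A f l"
  proof (rule word_invI[OF permutes_inv[OF p]])
    fix a b assume a: "a \<in> tuples n A" and b: "b \<in> tuples n A"
      and card: "card (sing_pos n a) = l" and ms: "ms n a = ms n b"
      and sb: "singles n b = map (\<lambda>i. a (h (sing_pos n a) (inv' \<sigma> i))) [1..<Suc l]"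
    have cb: "card (sing_pos n b) = l"
      unfolding length_singles[symmetric] sb by (simp del: upt_Suc)
    \<comment> \<open>Reordering the word of \<open>b\<close> by \<sigma> restores that of
      \<open>a\<close>, so membership of \<sigma> is applied to \<open>b\<close> and
      \<open>a\<close> in this order.\<close>
    have "singles n a = map (\<lambda>i. b (h (sing_pos n b) (\<sigma> i))) [1..<Suc l]"
    proof (rule singles_eqI[OF refl card])
      fix i assume "i \<in> {1..l}"
      then have "\<sigma> i \<in> {1..l}" using permutes_in_image[OF p] by blast
      then show "a (h (sing_pos n a) i) = b (h (sing_pos n b) (\<sigma> i))"
        using singles_eqD[OF sb] permutes_inverses(2)[OF p] by simp
    qed
    with \<sigma> b a cb ms[symmetric] have "f b = f a"
      by (rule word_invD)
    then show "f a = f b" ..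
  qed
  then show "inv\<^bsub>sym_group l\<^esub> \<sigma> \<in> word_inv n A f l"
    using p by (simp add: mem_sym_group)
qed

text \<open>Given invariance under \<sigma>, a reordering of the word by a pattern is realized by
  acting with \<sigma> on a tuple with suitably placed singletons. Conversely, the action of
  \<sigma> on any tuple reorders its word by a pattern whose size lies in \<open>Z\<close>.\<close>

lemma Inv_group_eq_Inter_Comp:
  assumes "determined_by_cs n A f" "n \<ge> 1" "Z (ecard A) n \<noteq> {}"
  shows "Inv_group n A f = (\<Inter>l\<in>Z (ecard A) n. Comp n l (word_inv n A f l))"
proof (intro Set.set_eqI iffI)
  fix \<sigma> assume "\<sigma> \<in> Inv_group n A f"
  then have p: "\<sigma> permutes {1..n}" and inv: "\<And>a. a \<in> tuples n A \<Longrightarrow> f (act n a \<sigma>) = f a"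
    by (auto simp: Inv_group_def mem_sym_group)
  have "pattern \<sigma> T \<in> word_inv n A f (card T)" if T: "T \<subseteq> {1..n}" for T
  proof (rule word_invI)
    have fT: "finite T" using T finite_subset by blast
    show pat: "pattern \<sigma> T permutes {1..card T}"
      by (rule pattern_permutes[OF p fT])
    fix a b assume a: "a \<in> tuples n A" and b: "b \<in> tuples n A"
      and card: "card (sing_pos n a) = card T" and ms: "ms n a = ms n b"
      and sb: "singles n b = map (\<lambda>i. a (h (sing_pos n a) (pattern \<sigma> T i))) [1..<Suc (card T)]"
    have sT: "\<sigma> ` T \<subseteq> {1..n}" "card (\<sigma> ` T) = card T"
      using image_mono[OF T, of \<sigma>] permutes_image[OF p] card_image_permutes[OF p] by simp_all
    obtain \<rho> where \<rho>: "\<rho> permutes {1..n}" "sing_pos n (act n a \<rho>) = \<sigma> ` T"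
      "\<And>i. i \<in> {1..card T} \<Longrightarrow> act n a \<rho> (h (\<sigma> ` T) i) = a (h (sing_pos n a) (id i))"
      using ex_act_with_sing_pos[OF sT card permutes_id] by blast
    let ?c = "act n a \<rho>"
    have c: "?c \<in> tuples n A" "ms n ?c = ms n a"
      using \<rho>(1) a by (simp_all add: act_mem_tuples ms_act)
    have "singles n ?c = singles n a"
      unfolding singles_eq[of n a] card using singles_eqI[OF \<rho>(2) sT(2) \<rho>(3)] by simp
    with assms(1) c(1) a c(2) have fc: "f ?c = f a"
      by (rule determined_by_csD)
    let ?d = "act n ?c \<sigma>"
    have d: "?d \<in> tuples n A" "ms n ?d = ms n b"
      using c p ms by (simp_all add: act_mem_tuples ms_act)
    have "\<sigma> ` sing_pos n ?d = \<sigma> ` T"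
      using image_sing_pos_act[OF p, of ?c] \<rho>(2) by simp
    then have posd: "sing_pos n ?d = T"
      using permutes_inj[OF p] by (metis inj_image_eq_iff)
    have "singles n ?d = singles n b"
      unfolding sb
    proof (rule singles_eqI[OF posd refl])
      fix i assume i: "i \<in> {1..card T}"
      then have pi: "pattern \<sigma> T i \<in> {1..card T}"
        using permutes_in_image[OF pat] by blast
      have "?d (h T i) = ?c (h (\<sigma> ` T) (pattern \<sigma> T i))"
        using act_h[OF p posd[symmetric] i] \<rho>(2) by simp
      also have "\<dots> = a (h (sing_pos n a) (pattern \<sigma> T i))"
        using \<rho>(3)[OF pi] by simp
      finally show "?d (h T i) = a (h (sing_pos n a) (pattern \<sigma> T i))" .
    qed
    with assms(1) d(1) b d(2) have "f ?d = f b"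
      by (rule determined_by_csD)
    then show "f a = f b" using fc inv[OF c(1)] by simp
  qed
  then show "\<sigma> \<in> (\<Inter>l\<in>Z (ecard A) n. Comp n l (word_inv n A f l))"
    unfolding mem_Inter_Comp[OF assms(3)] using p by blast
next
  fix \<sigma> assume "\<sigma> \<in> (\<Inter>l\<in>Z (ecard A) n. Comp n l (word_inv n A f l))"
  then have p: "\<sigma> permutes {1..n}" and pat: "\<And>T. T \<subseteq> {1..n} \<Longrightarrow> card T \<in> Z (ecard A) n \<Longrightarrow>
      pattern \<sigma> T \<in> word_inv n A f (card T)"
    unfolding mem_Inter_Comp[OF assms(3)] by auto
  have "f (act n a \<sigma>) = f a" if a: "a \<in> tuples n A" for a
  proof -
    let ?b = "act n a \<sigma>"
    let ?T = "sing_pos n ?b"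
    have c: "card (sing_pos n a) = card ?T"
      using card_sing_pos_act[OF p] by metis
    have "pattern \<sigma> ?T \<in> word_inv n A f (card ?T)"
      using sing_pos_subset c card_sing_pos_in_Z[OF a assms(2)] by (intro pat) auto
    moreover have "singles n ?b =
        map (\<lambda>i. a (h (sing_pos n a) (pattern \<sigma> ?T i))) [1..<Suc (card ?T)]"
      by (rule singles_eqI[OF refl refl]) (rule act_h[OF p refl])
    ultimately have "f a = f ?b"
      using word_invD[OF _ a act_mem_tuples[OF a p] c ms_act[OF p, symmetric]] by blast
    then show ?thesis ..
  qed
  then show "\<sigma> \<in> Inv_group n A f"
    using p by (auto simp: Inv_group_def mem_sym_group)
qed

section \<open>From a family of groups to a function\<close>

text \<open>One sequence serves all \<open>l\<close> at once. Each \<open>l\<close> calls for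
  \<open>l\<close> singletons and one repeated filler, hence \<open>Suc l\<close> values; for
  \<open>l = n\<close> there is no filler, hence the bound \<open>n\<close>.\<close>

lemma ex_inj_seq:
  obtains x :: "nat \<Rightarrow> 'a" where
    "\<And>l. l \<in> Z (ecard A) n \<Longrightarrow> inj_on x {1..min n (Suc l)}"
    "\<And>l. l \<in> Z (ecard A) n \<Longrightarrow> x ` {1..min n (Suc l)} \<subseteq> A"
proof -
  \<comment> \<open>This is the minimum of |A| and \<open>n\<close>, the largest number of distinct
    values required.\<close>
  define m where "m = (if ecard A < enat n then card A else n)"
  have "\<exists>T \<subseteq> A. finite T \<and> card T = m"
  proof (cases "finite A")
    case True
    then have "m \<le> card A" by (auto simp: m_def ecard_def)
    then show ?thesis using True by (metis obtain_subset_with_card_n)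
  next
    case False
    then show ?thesis using infinite_arbitrarily_large by blast
  qed
  then obtain T where T: "T \<subseteq> A" "finite T" "card T = m" by blast
  then obtain x where x: "bij_betw x {1..m} T"
    using ex_bij_betw_nat_finite_1 by blast
  have sub: "{1..min n (Suc l)} \<subseteq> {1..m}" if "l \<in> Z (ecard A) n" for l
    using that by (auto simp: Z_def m_def ecard_def split: if_splits)
  show thesis
  proof
    fix l assume "l \<in> Z (ecard A) n"
    note sub = sub[OF this]
    show "inj_on x {1..min n (Suc l)}"
      using bij_betw_imp_inj_on[OF x] sub by (rule inj_on_subset)
    show "x ` {1..min n (Suc l)} \<subseteq> A"
      using image_mono[OF sub, of x] bij_betw_imp_surj_on[OF x] T(1) by simp
  qed
qed

text \<open>The truncated index \<open>min i (Suc l)\<close> produces the tuple x_1, ..., x_l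
  followed by \<open>n - l\<close> copies of x_(l+1). The filler is never a singleton because
  \<open>l \<noteq> n - 1\<close>.\<close>

lemma sing_pos_model:
  assumes "l \<le> n" "l \<noteq> n - 1" "inj_on x {1..min n (Suc l)}"
  shows "sing_pos n (\<lambda>i\<in>{1..n}. x (min i (Suc l))) = {1..l}"
proof -
  have eq: "x (min i (Suc l)) = x (min j (Suc l)) \<longleftrightarrow> min i (Suc l) = min j (Suc l)"
    if "i \<in> {1..n}" "j \<in> {1..n}" for i j
    using assms(3) that by (intro inj_on_eq_iff) auto
  have "(\<forall>j\<in>{1..n}. min j (Suc l) = min i (Suc l) \<longrightarrow> j = i) \<longleftrightarrow> i \<le> l" if i: "i \<in> {1..n}" for i
  proof
    assume *: "\<forall>j\<in>{1..n}. min j (Suc l) = min i (Suc l) \<longrightarrow> j = i"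
    show "i \<le> l"
    proof (rule ccontr)
      assume "\<not> i \<le> l"
      \<comment> \<open>Positions \<open>n\<close> and \<open>Suc l\<close> both carry the filler,
        as does \<open>i\<close>, so uniqueness identifies all three.\<close>
      then have "n = i" "Suc l = i"
        using i bspec[OF *, of n] bspec[OF *, of "Suc l"] by (simp_all add: min_def)
      then show False using assms(2) by simp
    qed
  qed auto
  moreover have "sing_pos n (\<lambda>i\<in>{1..n}. x (min i (Suc l))) =
      {i \<in> {1..n}. \<forall>j\<in>{1..n}. min j (Suc l) = min i (Suc l) \<longrightarrow> j = i}"
    unfolding sing_pos_def using eq by (intro Collect_cong conj_cong ball_cong refl) simp
  ultimately show ?thesis
    using assms(1) by (auto simp del: atLeastAtMost_iff) auto
qed

text \<open>Closure of \<open>H l\<close> under products makes the indicator function invariant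
  under \<open>G\<close>. Conversely, since the entries of \<open>x\<close> used are distinct, the
  word of a rearranged model tuple reveals the pattern, which invariance forces into
  \<open>H l\<close>.\<close>

lemma Inter_Comp_eq_Inv_group:
  fixes A :: "'a set" and B :: "'b set"
  assumes "ecard B \<ge> 2" "n \<ge> 1" "Z (ecard A) n \<noteq> {}" "subgroup G (sym_group n)"
    and H: "\<And>l. l \<in> Z (ecard A) n \<Longrightarrow> subgroup (H l) (sym_group l)"
    and G: "G = (\<Inter>l\<in>Z (ecard A) n. Comp n l (H l))"
  obtains f where "f \<in> tuples n A \<rightarrow> B" "determined_by_cs n A f" "G = Inv_group n A f"
proof -
  let ?Z = "Z (ecard A) n"
  have "\<exists>b0\<in>B. \<exists>b1\<in>B. b0 \<noteq> b1"
  proof (rule ccontr)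
    assume "\<not> ?thesis"
    then obtain b where "B \<subseteq> {b}" by blast
    then have "finite B" "card B \<le> 1"
      using finite_subset[of B "{b}"] card_mono[of "{b}" B] by simp_all
    then show False
      using assms(1) by (simp add: ecard_def numeral_eq_enat)
  qed
  then obtain b0 b1 where B: "b0 \<in> B" "b1 \<in> B" "b0 \<noteq> b1" by blast
  obtain x :: "nat \<Rightarrow> 'a" where
    inj: "\<And>l. l \<in> ?Z \<Longrightarrow> inj_on x {1..min n (Suc l)}" and
    img: "\<And>l. l \<in> ?Z \<Longrightarrow> x ` {1..min n (Suc l)} \<subseteq> A"
    using ex_inj_seq[of A n] by blast
  define e where "e l = (\<lambda>i\<in>{1..n}. x (min i (Suc l)))" for l
  have e_tuple: "e l \<in> tuples n A" if "l \<in> ?Z" for l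
  proof -
    have "x (min i (Suc l)) \<in> A" if "i \<in> {1..n}" for i
      by (rule subsetD[OF img[OF \<open>l \<in> ?Z\<close>] imageI]) (use that in auto)
    then show ?thesis
      unfolding e_def tuples_def by (simp del: atLeastAtMost_iff)
  qed
  have e_pos: "sing_pos n (e l) = {1..l}" if "l \<in> ?Z" for l
    unfolding e_def using Z_le[OF that] Z_neq[OF that assms(2)] inj[OF that]
    by (rule sing_pos_model)
  have e_h: "e l (h {1..l} i) = x i" if "l \<in> ?Z" "i \<in> {1..l}" for i l
    using Z_le[OF that(1)] that(2) h_initial_segment[OF that(2)] by (auto simp: e_def min_def)
  \<comment> \<open>The length of the word determines \<open>l\<close>, so no two different
    \<open>l\<close> can witness \<open>P a\<close>.\<close>
  define P where "P a \<longleftrightarrow> (\<exists>l\<in>?Z. \<exists>\<tau>\<in>H l. ms n a = ms n (e l) \<and>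
      singles n a = map (\<lambda>i. x (\<tau> i)) [1..<Suc l])" for a
  define f where "f a = (if P a then b1 else b0)" for a
  have f_act: "f (act n a \<sigma>) = f a \<longleftrightarrow> P (act n a \<sigma>) = P a" for a \<sigma>
    using B(3) by (auto simp: f_def)
  have P_act: "P (act n a \<sigma>)" if \<sigma>: "\<sigma> \<in> G" and "P a" for \<sigma> a
  proof -
    have p: "\<sigma> permutes {1..n}" and pat: "\<And>T. T \<subseteq> {1..n} \<Longrightarrow> card T \<in> ?Z \<Longrightarrow>
        pattern \<sigma> T \<in> H (card T)"
      using \<sigma> unfolding G mem_Inter_Comp[OF assms(3)] by auto
    obtain l \<tau> where l: "l \<in> ?Z" "\<tau> \<in> H l" "ms n a = ms n (e l)"
        "singles n a = map (\<lambda>i. x (\<tau> i)) [1..<Suc l]"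
      using \<open>P a\<close> by (auto simp: P_def)
    let ?b = "act n a \<sigma>"
    let ?T = "sing_pos n ?b"
    have cT: "card ?T = l"
      using l(4) length_singles[of n a] card_sing_pos_act[OF p, of a] by (simp del: upt_Suc)
    have pT: "pattern \<sigma> ?T \<in> H l"
      using pat[of ?T] sing_pos_subset cT l(1) by metis
    have "singles n ?b = map (\<lambda>i. x ((\<tau> \<circ> pattern \<sigma> ?T) i)) [1..<Suc l]"
    proof (rule singles_eqI[OF refl cT])
      fix i assume i: "i \<in> {1..l}"
      then have "pattern \<sigma> ?T i \<in> {1..l}"
        using permutes_in_image[OF pattern_permutes[OF p finite_sing_pos]] cT by metis
      then show "?b (h ?T i) = x ((\<tau> \<circ> pattern \<sigma> ?T) i)"
        using act_h[OF p refl, of i a] i cT singles_eqD[OF l(4)] by simp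
    qed
    moreover have "\<tau> \<circ> pattern \<sigma> ?T \<in> H l"
      using subgroup.m_closed[OF H[OF l(1)] l(2) pT] by (simp add: sym_group_def)
    ultimately show ?thesis
      using l(1,3) ms_act[OF p, of a] unfolding P_def by metis
  qed
  have "G = Inv_group n A f"
  proof (intro Set.set_eqI iffI)
    fix \<sigma> assume \<sigma>: "\<sigma> \<in> G"
    with assms(4) have car: "\<sigma> \<in> carrier (sym_group n)"
      by (rule subgroup.mem_carrier)
    then have p: "\<sigma> permutes {1..n}" by (simp add: mem_sym_group)
    have inv: "inv' \<sigma> \<in> G"
      using subgroup.m_inv_closed[OF assms(4) \<sigma>] unfolding sym_group_inv_equality[OF car] .
    \<comment> \<open>The reverse implication comes from acting with the inverse of \<sigma>, which
      also lies in \<open>G\<close>.\<close>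
    have "P a" if a: "a \<in> tuples n A" and "P (act n a \<sigma>)" for a
    proof -
      have "act n (act n a \<sigma>) (inv' \<sigma>) = a"
      proof
        fix i
        show "act n (act n a \<sigma>) (inv' \<sigma>) i = a i"
        proof (cases "i \<in> {1..n}")
          case True
          then have "inv' \<sigma> i \<in> {1..n}"
            using permutes_in_image[OF permutes_inv[OF p]] by blast
          then show ?thesis
            using True permutes_inverses(1)[OF p] unfolding act_def by simp
        next
          case False
          moreover have "a i = undefined"
            \<comment> \<open>Outside \<open>{1..n}\<close> both sides are \<open>undefined\<close>,
              as tuples are extensional.\<close>
            using a False unfolding tuples_def by (rule PiE_arb)
          ultimately show ?thesis
            unfolding act_def by auto
        qed
      qed
      then show ?thesis using P_act[OF inv that(2)] by (simp only:)
    qed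
    then show "\<sigma> \<in> Inv_group n A f"
      using P_act[OF \<sigma>] car unfolding Inv_group_def f_act by blast
  next
    fix \<sigma> assume "\<sigma> \<in> Inv_group n A f"
    then have p: "\<sigma> permutes {1..n}" and
      inv: "\<And>a. a \<in> tuples n A \<Longrightarrow> P (act n a \<sigma>) = P a"
      by (auto simp: Inv_group_def mem_sym_group f_act)
    have "pattern \<sigma> T \<in> H (card T)" if T: "T \<subseteq> {1..n}" "card T \<in> ?Z" for T
    proof -
      let ?l = "card T"
      have fT: "finite T" using T finite_subset by blast
      have sT: "\<sigma> ` T \<subseteq> {1..n}" "card (\<sigma> ` T) = ?l"
        using image_mono[OF T(1), of \<sigma>] permutes_image[OF p] card_image_permutes[OF p] by simp_all
      have "card (sing_pos n (e ?l)) = ?l" using e_pos[OF T(2)] by simp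
      from ex_act_with_sing_pos[OF sT this permutes_id] obtain \<rho> where \<rho>: "\<rho> permutes {1..n}" "sing_pos n (act n (e ?l) \<rho>) = \<sigma> ` T"
        "\<And>i. i \<in> {1..?l} \<Longrightarrow> act n (e ?l) \<rho> (h (\<sigma> ` T) i) = e ?l (h (sing_pos n (e ?l)) (id i))"
        by blast
      let ?c = "act n (e ?l) \<rho>"
      have c: "?c \<in> tuples n A" "ms n ?c = ms n (e ?l)"
        using \<rho>(1) e_tuple[OF T(2)] by (simp_all add: act_mem_tuples ms_act)
      have c_h: "?c (h (\<sigma> ` T) i) = x i" if "i \<in> {1..?l}" for i
        using \<rho>(3)[OF that] e_pos[OF T(2)] e_h[OF T(2) that] by simp
      have "singles n ?c = map (\<lambda>i. x (id i)) [1..<Suc ?l]"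
        unfolding id_apply by (rule singles_eqI[OF \<rho>(2) sT(2) c_h])
      moreover have "id \<in> H ?l"
        using subgroup.one_closed[OF H[OF T(2)]] by (simp add: sym_group_def)
      ultimately have "P ?c"
        using c T(2) unfolding P_def by blast
      let ?d = "act n ?c \<sigma>"
      have "\<sigma> ` sing_pos n ?d = \<sigma> ` T"
        using image_sing_pos_act[OF p, of ?c] \<rho>(2) by simp
      then have posd: "sing_pos n ?d = T"
        using permutes_inj[OF p] by (metis inj_image_eq_iff)
      have "P ?d" using inv[OF c(1)] \<open>P ?c\<close> by simp
      then obtain l \<tau> where l: "\<tau> \<in> H l" "singles n ?d = map (\<lambda>i. x (\<tau> i)) [1..<Suc l]"
        by (auto simp: P_def)
      have [simp]: "l = ?l"
        using l(2) length_singles[of n ?d] posd by (simp del: upt_Suc)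
      have p\<tau>: "\<tau> permutes {1..?l}"
        using subgroup.mem_carrier[OF H[OF T(2)]] l(1) by (simp add: mem_sym_group)
      have ppat: "pattern \<sigma> T permutes {1..?l}"
        by (rule pattern_permutes[OF p fT])
      \<comment> \<open>The word of \<open>?d\<close> is expressed once through \<tau>, by
        \<open>P ?d\<close>, and once through the pattern; injectivity of \<open>x\<close>
        identifies the indices.\<close>
      have "\<tau> i = pattern \<sigma> T i" for i
      proof (cases "i \<in> {1..?l}")
        case i: True
        then have m: "\<tau> i \<in> {1..?l}" "pattern \<sigma> T i \<in> {1..?l}"
          using permutes_in_image[OF p\<tau>] permutes_in_image[OF ppat] by auto
        have "x (\<tau> i) = ?d (h T i)"
          using singles_eqD[OF l(2), of i] i posd by simp
        also have "\<dots> = ?c (h (\<sigma> ` T) (pattern \<sigma> T i))"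
          using act_h[OF p, of T ?c i] posd i \<rho>(2) by simp
        also have "\<dots> = x (pattern \<sigma> T i)"
          by (rule c_h[OF m(2)])
        finally show ?thesis
          using inj[OF T(2)] m Z_le[OF T(2)] by (auto dest!: inj_onD)
      next
        case False
        then show ?thesis
          using permutes_not_in[OF p\<tau>] permutes_not_in[OF ppat] by metis
      qed
      then have "\<tau> = pattern \<sigma> T" by (rule ext)
      then show ?thesis using l(1) by simp
    qed
    then show "\<sigma> \<in> G"
      unfolding G mem_Inter_Comp[OF assms(3)] using p by blast
  qed
  moreover have "f \<in> tuples n A \<rightarrow> B" using B by (auto simp: f_def)
  moreover have "determined_by_cs n A f"
    by (auto simp: determined_by_cs_def cs_def f_def P_def)
  ultimately show thesis using that by blast
qed

theorem theorem5p7: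
  fixes A :: "'a set" and B :: "'b set" and k :: enat and n :: nat
    and G :: "(nat \<Rightarrow> nat) set"
  assumes "ecard A = k" and "k \<ge> 2" and "ecard B \<ge> 2" and "n \<ge> 1"
    and "subgroup G (sym_group n)"
  shows "(\<exists>f \<in> tuples n A \<rightarrow> B. determined_by_cs n A f \<and> G = Inv_group n A f) \<longleftrightarrow>
    (\<exists>H :: nat \<Rightarrow> (nat \<Rightarrow> nat) set. (\<forall>l\<in>Z k n. subgroup (H l) (sym_group l)) \<and>
       G = (\<Inter>l\<in>Z k n. Comp n l (H l)))"
proof
  assume "\<exists>f \<in> tuples n A \<rightarrow> B. determined_by_cs n A f \<and> G = Inv_group n A f"
  then obtain f :: "(nat \<Rightarrow> 'a) \<Rightarrow> 'b" where "determined_by_cs n A f" "G = Inv_group n A f" by blast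
  then show "\<exists>H. (\<forall>l\<in>Z k n. subgroup (H l) (sym_group l)) \<and> G = (\<Inter>l\<in>Z k n. Comp n l (H l))"
    using subgroup_word_inv[of n A f] Inv_group_eq_Inter_Comp[of n A f] Z_nonempty[OF assms(2,4)]
      assms(1,4) by (intro exI[of _ "word_inv n A f"]) blast
next
  assume "\<exists>H. (\<forall>l\<in>Z k n. subgroup (H l) (sym_group l)) \<and> G = (\<Inter>l\<in>Z k n. Comp n l (H l))"
  then obtain H where "\<And>l. l \<in> Z k n \<Longrightarrow> subgroup (H l) (sym_group l)"
      "G = (\<Inter>l\<in>Z k n. Comp n l (H l))" by blast
  then show "\<exists>f \<in> tuples n A \<rightarrow> B. determined_by_cs n A f \<and> G = Inv_group n A f"
    using Inter_Comp_eq_Inv_group[of B n A G H] Z_nonempty[OF assms(2,4)] assms by metis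
qed

end
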